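(* Every almost Lindelöf space $X$ with cardinality less than $\mathfrak{d}$ is almost Scheepers.
   Context: A topological space $X$ is almost Lindelöf if every open cover $\mathcal{U}$ of $X$ has a countable subset $\mathcal{V}$ such that $\{\overline{V}:V\in\mathcal{V}\}$ covers $X$. $X$ is almost Scheepers if for every sequence $(\mathcal{U}_n)_{n\in\mathbb{N}}$ of open covers of $X$ there are finite $\mathcal{V}_n\subseteq\mathcal{U}_n$ such that every finite set $F\subseteq X$ is contained in $\overline{\bigcup\mathcal{V}_n}$ for some $n$. For $f,g\in\mathbb{N}^{\mathbb{N}}$ write $f\leq^* g$ if $f(n)\leq g(n)$ for all but finitely many $n$. A set $D\subseteq\mathbb{N}^{\mathbb{N}}$ is dominating if for each $g\in\mathbb{N}^{\mathbb{N}}$ there is $f\in D$ with $g\leq^* f$; $\mathfrak{d}$ is the minimum cardinality of a dominating subset of $\mathbb{N}^{\mathbb{N}}$. *)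

theory Defs
  imports "HOL-Analysis.Analysis"
begin

unbundle cardinal_syntax

definition open_cover :: "'a topology \<Rightarrow> 'a set set \<Rightarrow> bool" where
  "open_cover X \<U> \<longleftrightarrow> (\<forall>U\<in>\<U>. openin X U) \<and> \<Union>\<U> = topspace X"

definition almost_Lindelof_space :: "'a topology \<Rightarrow> bool" where
  "almost_Lindelof_space X \<longleftrightarrow>
    (\<forall>\<U>. open_cover X \<U> \<longrightarrow>
      (\<exists>\<V>. countable \<V> \<and> \<V> \<subseteq> \<U> \<and> (\<Union>V\<in>\<V>. X closure_of V) = topspace X))"

definition almost_Scheepers_space :: "'a topology \<Rightarrow> bool" where
  "almost_Scheepers_space X \<longleftrightarrow>
    (\<forall>\<U> :: nat \<Rightarrow> 'a set set. (\<forall>n. open_cover X (\<U> n)) \<longrightarrow>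
      (\<exists>\<V> :: nat \<Rightarrow> 'a set set. (\<forall>n. finite (\<V> n) \<and> \<V> n \<subseteq> \<U> n) \<and>
        (\<forall>F. finite F \<and> F \<subseteq> topspace X \<longrightarrow> (\<exists>n. F \<subseteq> X closure_of (\<Union>(\<V> n))))))"

definition le_star :: "(nat \<Rightarrow> nat) \<Rightarrow> (nat \<Rightarrow> nat) \<Rightarrow> bool" (infix "\<le>\<^sup>*" 50) where
  "f \<le>\<^sup>* g \<longleftrightarrow> (\<forall>\<^sub>\<infinity>n. f n \<le> g n)"

definition dominating :: "(nat \<Rightarrow> nat) set \<Rightarrow> bool" where
  "dominating D \<longleftrightarrow> (\<forall>g. \<exists>f\<in>D. g \<le>\<^sup>* f)"

(* Cardinals are represented by well-order relations, so the minimum cardinality of a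
   dominating set is determined only up to order isomorphism =o; the choice below picks
   one representative |D| with D dominating of least cardinality.  The lemmas
   below show that such a D exists. *)
definition dominating_number :: "(nat \<Rightarrow> nat) rel" where
  "dominating_number =
    (SOME \<kappa>. \<exists>D. dominating D \<and> \<kappa> = |D| \<and> (\<forall>E. dominating E \<longrightarrow> |D| \<le>o |E| ))"

lemma dominating_UNIV: "dominating UNIV"
  unfolding dominating_def le_star_def by (meson UNIV_I always_eventually order_refl)

lemma dominating_number_attained:
  "\<exists>D. dominating D \<and> dominating_number = |D| \<and> (\<forall>E. dominating E \<longrightarrow> |D| \<le>o |E| )"
proof -
  have "\<exists>r\<in>card_of ` Collect dominating. \<forall>r'\<in>card_of ` Collect dominating. r \<le>o r'"
    by (rule exists_minim_Card_order) (use dominating_UNIV card_of_Card_order in auto)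
  then have "\<exists>\<kappa> D. dominating D \<and> \<kappa> = |D| \<and> (\<forall>E. dominating E \<longrightarrow> |D| \<le>o |E| )"
    by auto
  then show ?thesis
    unfolding dominating_number_def by (rule someI_ex)
qed

end

theory Submission
  imports Defs "HOL-Algebra.Free_Abelian_Groups"
begin

no_notation eq_closure_of (\<open>closure'_of\<index>\<close>)

text \<open>
  Enumerate the countable almost subcovers of the given covers and let \<open>f x n\<close> be the first
  index in the \<open>n\<close>-th enumeration whose member has \<open>x\<close> in its closure. Fewer than
  \<open>\<dd>\<close> points give fewer than \<open>\<dd>\<close> finite sums of the functions \<open>f x\<close>
  (if there are infinitely many points; otherwise take the sum over all of them), so some \<open>g\<close>
  is not eventually dominated by any of these sums. The first \<open>g n\<close> members of the \<open>n\<close>-th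
  subcover are then as required.
\<close>

lemma not_dominating_if_card_less:
  assumes "|E| <o dominating_number"
  shows "\<not> dominating E"
  using assms dominating_number_attained not_ordLess_ordLeq by metis

text \<open>A sum of naturals majorises each summand, so one \<open>n\<close> with
  \<open>s F n < g n\<close> serves all of \<open>F\<close> at once. The single \<open>g\<close>
  must work for every \<open>F\<close>, while \<open>n\<close> may vary with
  \<open>F\<close>.\<close>

lemma finitely_often_bounded:
  fixes f :: "'a \<Rightarrow> nat \<Rightarrow> nat"
  assumes "|A| <o dominating_number"
  obtains g where "\<And>F. finite F \<Longrightarrow> F \<subseteq> A \<Longrightarrow> \<exists>n. \<forall>x\<in>F. f x n \<le> g n"
proof -
  define s where "s F n = (\<Sum>x\<in>F. f x n)" for F n
  have s: "f x n \<le> s F n" if "finite F" "x \<in> F" for F x n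
    unfolding s_def using that by (intro member_le_sum) auto
  show thesis
  proof (cases "finite A")
    case True
    \<comment> \<open>The total sum bounds every \<open>f x\<close> everywhere, so any
      \<open>n\<close> will do.\<close>
    show thesis
      by (rule that[of "s A"]) (use s[OF True] in blast)
  next
    case False
    have "|s ` Fpow A| \<le>o |Fpow A|"
      by (rule card_of_image)
    \<comment> \<open>An infinite set has only as many finite subsets as elements, so passing to
      finite sums keeps the family too small to be dominating.\<close>
    moreover have "|Fpow A| =o |A|"
      using eqpoll_Fpow[OF False] by (simp add: eqpoll_iff_card_of_ordIso)
    ultimately have "|s ` Fpow A| <o dominating_number"
      using assms ordLeq_ordIso_trans ordLeq_ordLess_trans by blast
    then have "\<not> dominating (s ` Fpow A)"
      by (rule not_dominating_if_card_less)
    then obtain g where g: "\<And>F. F \<in> Fpow A \<Longrightarrow> \<not> g \<le>\<^sup>* s F"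
      unfolding dominating_def by blast
    show thesis
    proof (rule that)
      fix F assume F: "finite F" "F \<subseteq> A"
      then have "\<not> g \<le>\<^sup>* s F"
        by (intro g) (simp add: Fpow_def)
      then have "\<exists>\<^sub>\<infinity>n. s F n < g n"
        by (simp add: le_star_def not_le)
      then obtain n where "s F n < g n"
        by (blast dest: INFM_EX)
      then have "\<forall>x\<in>F. f x n \<le> g n"
        using s[OF F(1)] by (meson less_imp_le order_trans)
      then show "\<exists>n. \<forall>x\<in>F. f x n \<le> g n" ..
    qed
  qed
qed

theorem theorem3p9:
  fixes X :: "'a topology"
  assumes "almost_Lindelof_space X"
    and "|topspace X| <o dominating_number"
  shows "almost_Scheepers_space X"
  unfolding almost_Scheepers_space_def
proof (intro allI impI)
  fix \<U> :: "nat \<Rightarrow> 'a set set"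
  assume \<U>: "\<forall>n. open_cover X (\<U> n)"
  then have "\<forall>n. \<exists>\<W>. countable \<W> \<and> \<W> \<subseteq> \<U> n \<and> (\<Union>V\<in>\<W>. X closure_of V) = topspace X"
    using assms(1) unfolding almost_Lindelof_space_def by blast
  then obtain \<W> where \<W>: "\<And>n. countable (\<W> n)" "\<And>n. \<W> n \<subseteq> \<U> n"
    "\<And>n. (\<Union>V\<in>\<W> n. X closure_of V) = topspace X"
    by metis
  \<comment> \<open>The index \<open>k\<close> is attained for points of \<open>X\<close> only,
    since the closures of the members of \<open>\<W> n\<close> cover just
    \<open>topspace X\<close>.\<close>
  define f where "f x n = (LEAST k. \<exists>V\<in>\<W> n. to_nat_on (\<W> n) V = k \<and> x \<in> X closure_of V)" for x n
  have f: "\<exists>V\<in>\<W> n. to_nat_on (\<W> n) V = f x n \<and> x \<in> X closure_of V" if "x \<in> topspace X" for x n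
    unfolding f_def by (rule LeastI_ex) (use that \<W>(3)[of n] in blast)
  obtain g where g: "\<And>F. finite F \<Longrightarrow> F \<subseteq> topspace X \<Longrightarrow> \<exists>n. \<forall>x\<in>F. f x n \<le> g n"
    using finitely_often_bounded[OF assms(2), of f] by blast
  define \<V> where "\<V> n = {V \<in> \<W> n. to_nat_on (\<W> n) V \<le> g n}" for n
  \<comment> \<open>Distinct members of the countable \<open>\<W> n\<close> have distinct indices,
    and only \<open>g n + 1\<close> indices are allowed.\<close>
  have "finite (\<V> n)" for n
  proof (rule inj_on_finite)
    show "inj_on (to_nat_on (\<W> n)) (\<V> n)"
      by (rule inj_on_subset[OF inj_on_to_nat_on[OF \<W>(1)]]) (auto simp: \<V>_def)
    show "to_nat_on (\<W> n) ` \<V> n \<subseteq> {..g n}"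
      by (auto simp: \<V>_def)
  qed simp
  moreover have "\<V> n \<subseteq> \<U> n" for n
    using \<W>(2)[of n] by (auto simp: \<V>_def)
  moreover have "\<exists>n. F \<subseteq> X closure_of \<Union>(\<V> n)" if F: "finite F" "F \<subseteq> topspace X" for F
  proof -
    obtain n where n: "\<forall>x\<in>F. f x n \<le> g n"
      using g[OF F] by blast
    have "x \<in> X closure_of \<Union>(\<V> n)" if "x \<in> F" for x
    proof -
      obtain V where V: "V \<in> \<W> n" "to_nat_on (\<W> n) V = f x n" "x \<in> X closure_of V"
        using f F \<open>x \<in> F\<close> by blast
      \<comment> \<open>The index of \<open>V\<close> is \<open>f x n\<close>, at most
        \<open>g n\<close>, so \<open>V\<close> was kept in \<open>\<V> n\<close>.\<close>
      then have "V \<subseteq> \<Union>(\<V> n)"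
        using n \<open>x \<in> F\<close> by (auto simp: \<V>_def)
      then show ?thesis
        using closure_of_mono V(3) by blast
    qed
    then show ?thesis by blast
  qed
  ultimately show "\<exists>\<V>. (\<forall>n. finite (\<V> n) \<and> \<V> n \<subseteq> \<U> n) \<and>
      (\<forall>F. finite F \<and> F \<subseteq> topspace X \<longrightarrow> (\<exists>n. F \<subseteq> X closure_of \<Union>(\<V> n)))"
    by (intro exI[of _ \<V>]) simp
qed

end
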